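(* Let $\lambda>0$ and $\mu>0$. If $(\overline U,\overline V)$ is a local minimizer (respectively strong local minimizer) of $\widetilde F_\mu$, then it is also a local minimizer (respectively strong local minimizer) of $\Psi_{\lambda,\mu}$. Conversely, if $(\overline U,\overline V)$ is a nonzero local minimizer (respectively nonzero strong local minimizer) of $\Psi_{\lambda,\mu}$ and $J=\mathcal J(\overline U)$ is the index set of the nonzero columns of $\overline U$, then the pair of column submatrices $(\overline U_J,\overline V_J)$ is a local minimizer (respectively strong local minimizer) of $\widetilde F_\mu$ considered on the lower-dimensional space $\mathbb{R}^{n\times|J|}\times\mathbb{R}^{m\times|J|}$.
   Context: $n,m,r$ are positive integers and $X\in\mathbb{R}_+^{n\times m}$. $\|\cdot\|_F$ is the Frobenius norm, $\|W\|_{2,0}$ the number of nonzero columns of $W$; $\delta_{\mathbb{R}_+}(W)=0$ if $W\ge0$ entrywise and $+\infty$ otherwise. For any number $p$ of columns and $(U,V)\in\mathbb{R}^{n\times p}\times\mathbb{R}^{m\times p}$, $$\widetilde F_\mu(U,V)=\tfrac12\|X-UV^\top\|_F^2+\tfrac\mu2(\|U\|_F^2+\|V\|_F^2)+\delta_{\mathbb{R}_+}(U)+\delta_{\mathbb{R}_+}(V),$$ and $\Psi_{\lambda,\mu}(U,V)=\widetilde F_\mu(U,V)+\lambda(\|U\|_{2,0}+\|V\|_{2,0})$. The default space is $p=r$; in the converse part $\widetilde F_\mu$ is taken with $p=|J|$. $\overline U_J$ is the submatrix of $\overline U$ formed by the columns with index in $J$. A strong local minimizer of $f$ is a point $\bar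 z$ (with $f(\bar z)$ finite) for which there are $\alpha>0$ and a neighborhood of $\bar z$ on which $f(z)\ge f(\bar z)+\alpha\|z-\bar z\|_F^2$ (quadratic growth). *)

theory Defs
  imports "Jordan_Normal_Form.DL_Submatrix" "HOL-Library.Extended_Real"
begin

definition frob_norm :: "real mat \<Rightarrow> real" where
  "frob_norm A = sqrt (\<Sum>i<dim_row A. \<Sum>j<dim_col A. (A $$ (i, j))\<^sup>2)"

definition nonzero_cols :: "real mat \<Rightarrow> nat set" where
  "nonzero_cols W = {j. j < dim_col W \<and> col W j \<noteq> 0\<^sub>v (dim_row W)}"

definition norm20 :: "real mat \<Rightarrow> nat" where
  "norm20 W = card (nonzero_cols W)"

definition nonneg_entries :: "real mat \<Rightarrow> bool" where
  "nonneg_entries W \<longleftrightarrow> (\<forall>i<dim_row W. \<forall>j<dim_col W. 0 \<le> W $$ (i, j))"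

definition ind_nonneg :: "real mat \<Rightarrow> ereal" where
  "ind_nonneg W = (if nonneg_entries W then 0 else \<infinity>)"

text \<open>The number of columns is not a parameter of the two objectives: it is read off the
  arguments, so the same function serves on every space \<open>mat_pairs n m p\<close> below.\<close>

definition F_tilde :: "real mat \<Rightarrow> real \<Rightarrow> real mat \<times> real mat \<Rightarrow> ereal" where
  "F_tilde X \<mu> = (\<lambda>(U, V).
     ereal (1 / 2 * (frob_norm (X - U * transpose_mat V))\<^sup>2
            + \<mu> / 2 * ((frob_norm U)\<^sup>2 + (frob_norm V)\<^sup>2))
     + ind_nonneg U + ind_nonneg V)"

definition Psi :: "real mat \<Rightarrow> real \<Rightarrow> real \<Rightarrow> real mat \<times> real mat \<Rightarrow> ereal" where
  "Psi X l \<mu> = (\<lambda>(U, V).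
     F_tilde X \<mu> (U, V) + ereal (l * (real (norm20 U) + real (norm20 V))))"

definition mat_pairs :: "nat \<Rightarrow> nat \<Rightarrow> nat \<Rightarrow> (real mat \<times> real mat) set" where
  "mat_pairs n m p = carrier_mat n p \<times> carrier_mat m p"

definition pair_dist :: "real mat \<times> real mat \<Rightarrow> real mat \<times> real mat \<Rightarrow> real" where
  "pair_dist = (\<lambda>(U, V) (U', V').
     sqrt ((frob_norm (U - U'))\<^sup>2 + (frob_norm (V - V'))\<^sup>2))"

text \<open>Minimizers on the space \<open>S\<close> (always some \<open>mat_pairs n m p\<close>), with neighbourhoods given by
  Frobenius balls. Since \<open>f\<close> is extended-valued, a minimizer is required to have a finite value;
  otherwise every point with a strictly negative entry would be a local minimizer of \<open>F_tilde\<close>.\<close>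

definition local_minimizer ::
  "(real mat \<times> real mat) set \<Rightarrow> (real mat \<times> real mat \<Rightarrow> ereal) \<Rightarrow> real mat \<times> real mat \<Rightarrow> bool" where
  "local_minimizer S f z0 \<longleftrightarrow> z0 \<in> S \<and> \<bar>f z0\<bar> \<noteq> \<infinity> \<and>
     (\<exists>\<epsilon>>0. \<forall>z\<in>S. pair_dist z z0 < \<epsilon> \<longrightarrow> f z0 \<le> f z)"

definition strong_local_minimizer ::
  "(real mat \<times> real mat) set \<Rightarrow> (real mat \<times> real mat \<Rightarrow> ereal) \<Rightarrow> real mat \<times> real mat \<Rightarrow> bool" where
  "strong_local_minimizer S f z0 \<longleftrightarrow> z0 \<in> S \<and> \<bar>f z0\<bar> \<noteq> \<infinity> \<and>
     (\<exists>\<alpha>>0. \<exists>\<epsilon>>0. \<forall>z\<in>S. pair_dist z z0 < \<epsilon> \<longrightarrow>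
        f z0 + ereal (\<alpha> * (pair_dist z z0)\<^sup>2) \<le> f z)"

definition col_submatrix :: "real mat \<Rightarrow> nat set \<Rightarrow> real mat" where
  "col_submatrix W J = submatrix W UNIV J"

end

theory Submission
  imports Defs
begin

text \<open>Near \<open>U\<close> no nonzero column can vanish, so \<open>norm20\<close> can only increase and local
  minimality passes from \<open>F_tilde\<close> to \<open>Psi\<close>. Conversely, at a local minimizer of \<open>Psi\<close> the
  matrices \<open>U\<close> and \<open>V\<close> have the same nonzero columns: a column whose partner is zero does not
  contribute to \<open>U V\<^sup>T\<close>, and shrinking it would decrease the Frobenius penalty at no
  cost in \<open>norm20\<close>. Padding by zero columns then embeds the space with \<open>card J\<close> columns
  isometrically, preserving \<open>F_tilde\<close>, and \<open>norm20\<close> is maximal at \<open>(U, V)\<close> on its image.\<close>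

section \<open>Quadratic growth with a fixed constant\<close>

definition growth_minimizer ::
  "real \<Rightarrow> (real mat \<times> real mat) set \<Rightarrow> (real mat \<times> real mat \<Rightarrow> ereal) \<Rightarrow> real mat \<times> real mat \<Rightarrow> bool" where
  "growth_minimizer \<alpha> S f z0 \<longleftrightarrow> z0 \<in> S \<and> \<bar>f z0\<bar> \<noteq> \<infinity> \<and>
     (\<exists>\<epsilon>>0. \<forall>z\<in>S. pair_dist z z0 < \<epsilon> \<longrightarrow> f z0 + ereal (\<alpha> * (pair_dist z z0)\<^sup>2) \<le> f z)"

text \<open>The constant 0 turns the growth condition into plain local minimality. Transfer results
  for a fixed \<open>\<alpha>\<close> therefore treat local and strong local minimizers in a single
  proof.\<close>

lemma local_minimizer_iff_growth: "local_minimizer S f z \<longleftrightarrow> growth_minimizer 0 S f z"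
  by (simp add: local_minimizer_def growth_minimizer_def zero_ereal_def[symmetric])

lemma strong_local_minimizer_iff_growth:
  "strong_local_minimizer S f z \<longleftrightarrow> (\<exists>\<alpha>>0. growth_minimizer \<alpha> S f z)"
  by (auto simp: strong_local_minimizer_def growth_minimizer_def)

lemma growth_minimizer_mono:
  assumes "growth_minimizer \<alpha> S f z0" "\<beta> \<le> \<alpha>"
  shows "growth_minimizer \<beta> S f z0"
proof -
  have "f z0 + ereal (\<beta> * (pair_dist z z0)\<^sup>2) \<le> f z0 + ereal (\<alpha> * (pair_dist z z0)\<^sup>2)" for z
    using assms(2) by (intro add_left_mono) (simp add: mult_right_mono)
  then show ?thesis
    using assms(1) unfolding growth_minimizer_def by (meson order_trans)
qed

section \<open>Frobenius norms and nonzero columns\<close>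

lemma frob_norm_sq: "(frob_norm A)\<^sup>2 = (\<Sum>i<dim_row A. \<Sum>j<dim_col A. (A $$ (i, j))\<^sup>2)"
  unfolding frob_norm_def by (simp add: sum_nonneg)

lemma frob_norm_nonneg: "0 \<le> frob_norm A"
  unfolding frob_norm_def by (simp add: sum_nonneg)

lemma abs_entry_le_frob_norm:
  assumes "i < dim_row A" "j < dim_col A"
  shows "\<bar>A $$ (i, j)\<bar> \<le> frob_norm A"
proof -
  have "(A $$ (i, j))\<^sup>2 \<le> (\<Sum>j<dim_col A. (A $$ (i, j))\<^sup>2)"
    using assms by (intro member_le_sum) auto
  also have "\<dots> \<le> (\<Sum>i<dim_row A. \<Sum>j<dim_col A. (A $$ (i, j))\<^sup>2)"
    using assms by (intro member_le_sum[where f = "\<lambda>i. \<Sum>j<dim_col A. (A $$ (i, j))\<^sup>2"])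
      (auto intro: sum_nonneg)
  finally have "\<bar>A $$ (i, j)\<bar>\<^sup>2 \<le> (frob_norm A)\<^sup>2"
    by (simp add: frob_norm_sq)
  then show ?thesis
    using frob_norm_nonneg power2_le_imp_le by blast
qed

lemma frob_norm_le_pair_dist:
  "frob_norm (A - C) \<le> pair_dist (A, B) (C, D)" "frob_norm (B - D) \<le> pair_dist (A, B) (C, D)"
  by (simp_all add: pair_dist_def real_le_rsqrt)

lemma nonzero_cols_iff:
  "j \<in> nonzero_cols W \<longleftrightarrow> j < dim_col W \<and> (\<exists>i<dim_row W. W $$ (i, j) \<noteq> 0)"
  by (auto simp: nonzero_cols_def vec_eq_iff)

lemma finite_nonzero_cols: "finite (nonzero_cols W)"
  by (simp add: nonzero_cols_def)

text \<open>An entry moves by at most the Frobenius distance, so a perturbation smaller than every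
  nonzero entry of \<open>U\<close> in absolute value cannot annihilate any of them.\<close>

lemma nonzero_cols_lower_semicontinuous:
  assumes "U \<in> carrier_mat n p"
  obtains \<epsilon> where "\<epsilon> > 0"
    and "\<And>W. W \<in> carrier_mat n p \<Longrightarrow> frob_norm (W - U) < \<epsilon> \<Longrightarrow> nonzero_cols U \<subseteq> nonzero_cols W"
proof
  \<comment> \<open>The radius will be the least absolute value of a nonzero entry, capped at 1; the
    extra 1 keeps the set nonempty when \<open>U\<close> is zero.\<close>
  define E where "E = insert 1 ((\<lambda>x. \<bar>U $$ x\<bar>) ` {x \<in> {..<n} \<times> {..<p}. U $$ x \<noteq> 0})"
  have fin: "finite E" unfolding E_def by simp
  show "Min E > 0" using fin by (subst Min_gr_iff) (auto simp: E_def)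
  fix W assume W: "W \<in> carrier_mat n p" and d: "frob_norm (W - U) < Min E"
  show "nonzero_cols U \<subseteq> nonzero_cols W"
  proof
    fix j assume "j \<in> nonzero_cols U"
    then obtain i where ij: "i < n" "j < p" "U $$ (i, j) \<noteq> 0"
      using assms by (auto simp: nonzero_cols_iff)
    have "\<bar>(W - U) $$ (i, j)\<bar> \<le> frob_norm (W - U)"
      using ij assms W by (intro abs_entry_le_frob_norm) auto
    also have "\<dots> < \<bar>U $$ (i, j)\<bar>"
      using d fin ij by (subst (asm) Min_gr_iff) (auto simp: E_def)
    finally have "W $$ (i, j) \<noteq> 0" using ij assms W by auto
    then show "j \<in> nonzero_cols W" using ij W by (auto simp: nonzero_cols_iff)
  qed
qed

section \<open>From \<open>F_tilde\<close> to \<open>Psi\<close>\<close>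

definition smooth_part :: "real mat \<Rightarrow> real \<Rightarrow> real mat \<Rightarrow> real mat \<Rightarrow> real" where
  "smooth_part X \<mu> U V = 1 / 2 * (frob_norm (X - U * transpose_mat V))\<^sup>2
     + \<mu> / 2 * ((frob_norm U)\<^sup>2 + (frob_norm V)\<^sup>2)"

text \<open>Merging both indicators into one case distinction leaves real arithmetic on feasible
  pairs; elsewhere the value is infinite and every lower bound is automatic.\<close>

lemma F_tilde_eq:
  "F_tilde X \<mu> (U, V) =
     (if nonneg_entries U \<and> nonneg_entries V then ereal (smooth_part X \<mu> U V) else \<infinity>)"
  by (auto simp: F_tilde_def smooth_part_def ind_nonneg_def)

lemma Psi_eq:
  "Psi X l \<mu> (U, V) =
     (if nonneg_entries U \<and> nonneg_entries V
      then ereal (smooth_part X \<mu> U V + l * (real (norm20 U) + real (norm20 V))) else \<infinity>)"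
  by (auto simp: Psi_def F_tilde_eq)

text \<open>Supports can only grow near \<open>(U, V)\<close>, so the sparsity term is itself
  locally minimal there. Adding it preserves the growth inequality with the same
  \<open>\<alpha>\<close>.\<close>

lemma growth_minimizer_Psi_if_F_tilde:
  assumes "l \<ge> 0" and min: "growth_minimizer \<alpha> (mat_pairs n m p) (F_tilde X \<mu>) (U, V)"
  shows "growth_minimizer \<alpha> (mat_pairs n m p) (Psi X l \<mu>) (U, V)"
proof -
  from min have U: "U \<in> carrier_mat n p" and V: "V \<in> carrier_mat m p"
    and nonneg: "nonneg_entries U" "nonneg_entries V"
    by (auto simp: growth_minimizer_def mat_pairs_def F_tilde_eq split: if_splits)
  obtain \<epsilon>\<^sub>0 where \<epsilon>\<^sub>0: "\<epsilon>\<^sub>0 > 0" and growth: "\<And>z. z \<in> mat_pairs n m p \<Longrightarrow> pair_dist z (U, V) < \<epsilon>\<^sub>0 \<Longrightarrow>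
      F_tilde X \<mu> (U, V) + ereal (\<alpha> * (pair_dist z (U, V))\<^sup>2) \<le> F_tilde X \<mu> z"
    using min by (auto simp: growth_minimizer_def)
  obtain \<epsilon>\<^sub>1 where \<epsilon>\<^sub>1: "\<epsilon>\<^sub>1 > 0" and colsU: "\<And>W. W \<in> carrier_mat n p \<Longrightarrow>
      frob_norm (W - U) < \<epsilon>\<^sub>1 \<Longrightarrow> nonzero_cols U \<subseteq> nonzero_cols W"
    using nonzero_cols_lower_semicontinuous[OF U] by blast
  obtain \<epsilon>\<^sub>2 where \<epsilon>\<^sub>2: "\<epsilon>\<^sub>2 > 0" and colsV: "\<And>W. W \<in> carrier_mat m p \<Longrightarrow>
      frob_norm (W - V) < \<epsilon>\<^sub>2 \<Longrightarrow> nonzero_cols V \<subseteq> nonzero_cols W"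
    using nonzero_cols_lower_semicontinuous[OF V] by blast
  have "Psi X l \<mu> (U, V) + ereal (\<alpha> * (pair_dist (A, B) (U, V))\<^sup>2) \<le> Psi X l \<mu> (A, B)"
    if AB: "(A, B) \<in> mat_pairs n m p" and d: "pair_dist (A, B) (U, V) < min \<epsilon>\<^sub>0 (min \<epsilon>\<^sub>1 \<epsilon>\<^sub>2)"
    for A B
  proof -
    have "frob_norm (A - U) < \<epsilon>\<^sub>1" "frob_norm (B - V) < \<epsilon>\<^sub>2"
      \<comment> \<open>The variables of the two facts occur in different orders: the first
        instantiation yields the bound for \<open>A - U\<close>, the second the one for
        \<open>B - V\<close>.\<close>
      using d frob_norm_le_pair_dist[of A U B V] frob_norm_le_pair_dist[of B V A U] by auto
    then have "norm20 U \<le> norm20 A" "norm20 V \<le> norm20 B"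
      using AB colsU[of A] colsV[of B] unfolding norm20_def mat_pairs_def
      by (auto intro!: card_mono finite_nonzero_cols)
    then have "l * (real (norm20 U) + real (norm20 V)) \<le> l * (real (norm20 A) + real (norm20 B))"
      using \<open>l \<ge> 0\<close> by (intro mult_left_mono) auto
    then show ?thesis
      using growth[OF AB] d nonneg by (auto simp: F_tilde_eq Psi_eq split: if_splits)
  qed
  moreover have "min \<epsilon>\<^sub>0 (min \<epsilon>\<^sub>1 \<epsilon>\<^sub>2) > 0"
    using \<epsilon>\<^sub>0 \<epsilon>\<^sub>1 \<epsilon>\<^sub>2 by simp
  moreover have "\<bar>Psi X l \<mu> (U, V)\<bar> \<noteq> \<infinity>"
    using nonneg by (simp add: Psi_eq)
  moreover have "(U, V) \<in> mat_pairs n m p"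
    using U V by (simp add: mat_pairs_def)
  ultimately show ?thesis
    unfolding growth_minimizer_def by (metis surj_pair)
qed

section \<open>Equality of the supports at a minimizer of \<open>Psi\<close>\<close>

definition scale_cols_outside :: "nat set \<Rightarrow> real \<Rightarrow> real mat \<Rightarrow> real mat" where
  "scale_cols_outside K s A =
     mat (dim_row A) (dim_col A) (\<lambda>(i, j). if j \<in> K then A $$ (i, j) else s * A $$ (i, j))"

text \<open>This is the squared Frobenius norm of the part of \<open>A\<close> outside the columns
  in \<open>K\<close>; its vanishing places the support of \<open>A\<close> inside
  \<open>K\<close>.\<close>

definition mass_outside :: "nat set \<Rightarrow> real mat \<Rightarrow> real" where
  "mass_outside K A = (\<Sum>i<dim_row A. \<Sum>j<dim_col A. if j \<in> K then 0 else (A $$ (i, j))\<^sup>2)"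

lemma scale_cols_outside_carrier:
  "A \<in> carrier_mat n p \<Longrightarrow> scale_cols_outside K s A \<in> carrier_mat n p"
  by (auto simp: scale_cols_outside_def)

lemma mass_outside_nonneg: "0 \<le> mass_outside K A"
  by (auto simp: mass_outside_def intro!: sum_nonneg)

lemma nonzero_cols_subset_if_mass_outside_zero:
  assumes "mass_outside K A = 0"
  shows "nonzero_cols A \<subseteq> K"
proof
  fix j assume "j \<in> nonzero_cols A"
  then obtain i where ij: "i < dim_row A" "j < dim_col A" "A $$ (i, j) \<noteq> 0"
    by (auto simp: nonzero_cols_iff)
  have "\<forall>i\<in>{..<dim_row A}. (\<Sum>j<dim_col A. if j \<in> K then 0 else (A $$ (i, j))\<^sup>2) = 0"
    using assms unfolding mass_outside_def
    by (subst (asm) sum_nonneg_eq_0_iff) (auto intro!: sum_nonneg)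
  then have "\<forall>j\<in>{..<dim_col A}. (if j \<in> K then 0 else (A $$ (i, j))\<^sup>2) = 0"
    using ij by (subst (asm) sum_nonneg_eq_0_iff) auto
  then show "j \<in> K" using ij by (auto split: if_splits)
qed

lemma frob_norm_scale_cols_outside:
  "(frob_norm (scale_cols_outside K s A))\<^sup>2 = (frob_norm A)\<^sup>2 - (1 - s\<^sup>2) * mass_outside K A"
proof -
  have "(scale_cols_outside K s A $$ (i, j))\<^sup>2 =
      (A $$ (i, j))\<^sup>2 - (1 - s\<^sup>2) * (if j \<in> K then 0 else (A $$ (i, j))\<^sup>2)"
    if "i < dim_row A" "j < dim_col A" for i j
    using that by (simp add: scale_cols_outside_def power_mult_distrib left_diff_distrib)
  moreover have "dim_row (scale_cols_outside K s A) = dim_row A"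
    "dim_col (scale_cols_outside K s A) = dim_col A"
    by (simp_all add: scale_cols_outside_def)
  ultimately show ?thesis
    unfolding frob_norm_sq mass_outside_def sum_distrib_left sum_subtractf[symmetric]
    by (auto intro!: sum.cong)
qed

lemma frob_norm_scale_cols_outside_diff:
  "(frob_norm (scale_cols_outside K s A - A))\<^sup>2 = (1 - s)\<^sup>2 * mass_outside K A"
proof -
  have "((scale_cols_outside K s A - A) $$ (i, j))\<^sup>2 =
      (1 - s)\<^sup>2 * (if j \<in> K then 0 else (A $$ (i, j))\<^sup>2)"
    if "i < dim_row A" "j < dim_col A" for i j
  proof -
    have "s * A $$ (i, j) - A $$ (i, j) = (s - 1) * A $$ (i, j)"
      by (simp add: left_diff_distrib)
    then show ?thesis
      using that
      by (simp add: scale_cols_outside_def power_mult_distrib power2_commute[of s])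
  qed
  moreover have "dim_row (scale_cols_outside K s A - A) = dim_row A"
    "dim_col (scale_cols_outside K s A - A) = dim_col A"
    by simp_all
  ultimately show ?thesis
    unfolding frob_norm_sq mass_outside_def sum_distrib_left
    by (auto intro!: sum.cong)
qed

text \<open>Shrinking a column, unlike deleting it, keeps \<open>norm20\<close>, so the sparsity
  terms cancel when a scaled pair is compared with the original.\<close>

lemma nonzero_cols_scale_cols_outside:
  "s \<noteq> 0 \<Longrightarrow> nonzero_cols (scale_cols_outside K s A) = nonzero_cols A"
proof -
  assume "s \<noteq> 0"
  then have "scale_cols_outside K s A $$ (i, j) \<noteq> 0 \<longleftrightarrow> A $$ (i, j) \<noteq> 0"
    if "i < dim_row A" "j < dim_col A" for i j
    using that by (simp add: scale_cols_outside_def)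
  moreover have "dim_row (scale_cols_outside K s A) = dim_row A"
    "dim_col (scale_cols_outside K s A) = dim_col A"
    by (simp_all add: scale_cols_outside_def)
  ultimately show ?thesis
    unfolding set_eq_iff nonzero_cols_iff by metis
qed

lemma nonneg_entries_scale_cols_outside:
  "s \<ge> 0 \<Longrightarrow> nonneg_entries A \<Longrightarrow> nonneg_entries (scale_cols_outside K s A)"
  by (auto simp: nonneg_entries_def scale_cols_outside_def)

text \<open>For \<open>k\<close> outside \<open>K\<close> one of the two \<open>k\<close>-th columns
  is zero, so their contribution to the product vanishes before and after scaling; columns in
  \<open>K\<close> are untouched.\<close>

lemma scale_cols_outside_mult_transpose:
  assumes "U \<in> carrier_mat n p" "V \<in> carrier_mat m p"
    and K: "K = nonzero_cols U \<inter> nonzero_cols V"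
  shows "scale_cols_outside K s U * transpose_mat (scale_cols_outside K s V) = U * transpose_mat V"
proof (rule eq_matI)
  fix i j assume "i < dim_row (U * transpose_mat V)" "j < dim_col (U * transpose_mat V)"
  then have ij: "i < n" "j < m" using assms by auto
  have zero: "U $$ (i, k) = 0 \<or> V $$ (j, k) = 0" if "k < p" "k \<notin> K" for k
    using that ij assms by (auto simp: K nonzero_cols_iff)
  have "scale_cols_outside K s U $$ (i, k) * scale_cols_outside K s V $$ (j, k) =
      U $$ (i, k) * V $$ (j, k)" if "k < p" for k
    using that ij assms(1,2) zero[OF that] by (auto simp: scale_cols_outside_def)
  then show "(scale_cols_outside K s U * transpose_mat (scale_cols_outside K s V)) $$ (i, j) =
      (U * transpose_mat V) $$ (i, j)"
    using ij assms(1,2) scale_cols_outside_carrier[OF assms(1), of K s]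
      scale_cols_outside_carrier[OF assms(2), of K s]
    by (simp add: scalar_prod_def)
qed (use assms in \<open>auto simp: scale_cols_outside_def\<close>)

text \<open>The competitor shrinks, in both factors, all columns outside the common support
  \<open>K\<close>. Product and \<open>norm20\<close> stay fixed, so minimality compares only
  Frobenius penalties and forces the mass outside \<open>K\<close> to be zero.\<close>

lemma nonzero_cols_eq_if_local_minimizer_Psi:
  assumes "\<mu> > 0" and min: "local_minimizer (mat_pairs n m p) (Psi X l \<mu>) (U, V)"
  shows "nonzero_cols U = nonzero_cols V"
proof -
  from min have U: "U \<in> carrier_mat n p" and V: "V \<in> carrier_mat m p"
    and nonneg: "nonneg_entries U" "nonneg_entries V"
    by (auto simp: local_minimizer_def mat_pairs_def Psi_eq split: if_splits)
  obtain \<epsilon> where \<epsilon>: "\<epsilon> > 0" and le: "\<And>z. z \<in> mat_pairs n m p \<Longrightarrow> pair_dist z (U, V) < \<epsilon> \<Longrightarrow>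
      Psi X l \<mu> (U, V) \<le> Psi X l \<mu> z"
    using min by (auto simp: local_minimizer_def)
  define K where "K = nonzero_cols U \<inter> nonzero_cols V"
  define S where "S = mass_outside K U + mass_outside K V"
  have S: "S \<ge> 0" by (simp add: S_def mass_outside_nonneg)
  \<comment> \<open>The competitor lies at distance \<open>t * sqrt S\<close>, which the second
    bound makes less than \<epsilon>; the \<open>+ 1\<close> avoids division by zero when
    \<open>S = 0\<close>. The bound \<open>1 / 2\<close> keeps \<open>1 - t\<close> positive, hence
    signs and supports intact.\<close>
  define t where "t = min (1 / 2) (\<epsilon> / (2 * (sqrt S + 1)))"
  have t: "0 < t" "t < 1" using \<epsilon> S by (auto simp: t_def add_nonneg_pos)
  let ?A = "scale_cols_outside K (1 - t) U" and ?B = "scale_cols_outside K (1 - t) V"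
  have "pair_dist (?A, ?B) (U, V) = sqrt (t\<^sup>2 * S)"
    by (simp add: pair_dist_def frob_norm_scale_cols_outside_diff S_def algebra_simps)
  also have "\<dots> = t * sqrt S" using t by (simp add: real_sqrt_mult)
  also have "\<dots> \<le> \<epsilon> / (2 * (sqrt S + 1)) * sqrt S"
    using S by (intro mult_right_mono) (auto simp: t_def)
  also have "\<dots> < \<epsilon>"
  proof -
    have "\<epsilon> * sqrt S < \<epsilon> * (2 * (sqrt S + 1))"
      using \<epsilon> S by (intro mult_strict_left_mono) (auto simp: add_nonneg_pos)
    then show ?thesis
      using S by (simp add: divide_less_eq add_nonneg_pos)
  qed
  finally have "Psi X l \<mu> (U, V) \<le> Psi X l \<mu> (?A, ?B)"
    using U V by (intro le) (auto simp: mat_pairs_def scale_cols_outside_carrier)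
  then have "smooth_part X \<mu> U V \<le> smooth_part X \<mu> ?A ?B"
    using nonneg t
    by (simp add: Psi_eq norm20_def nonzero_cols_scale_cols_outside nonneg_entries_scale_cols_outside)
  then have "\<mu> * ((frob_norm U)\<^sup>2 + (frob_norm V)\<^sup>2) \<le> \<mu> * ((frob_norm ?A)\<^sup>2 + (frob_norm ?B)\<^sup>2)"
    by (simp add: smooth_part_def scale_cols_outside_mult_transpose[OF U V K_def])
  then have "(frob_norm U)\<^sup>2 + (frob_norm V)\<^sup>2 \<le> (frob_norm ?A)\<^sup>2 + (frob_norm ?B)\<^sup>2"
    using \<open>\<mu> > 0\<close> by simp
  \<comment> \<open>The left-hand side is exactly the drop of the sum of squared norms, which
    minimality forbids to be positive.\<close>
  then have "(1 - (1 - t)\<^sup>2) * S \<le> 0"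
    by (simp add: frob_norm_scale_cols_outside S_def distrib_left)
  moreover have "1 - (1 - t)\<^sup>2 > 0"
    using t by (simp add: power2_eq_square algebra_simps)
  ultimately have "S = 0" using S by (simp add: mult_le_0_iff)
  \<comment> \<open>Both supports now lie in their own intersection.\<close>
  then have "mass_outside K U = 0" "mass_outside K V = 0"
    using mass_outside_nonneg[of K U] mass_outside_nonneg[of K V] by (auto simp: S_def)
  then show ?thesis
    using nonzero_cols_subset_if_mass_outside_zero unfolding K_def by blast
qed

section \<open>Padding by zero columns and the converse transfer\<close>

definition pad_cols :: "nat set \<Rightarrow> nat \<Rightarrow> real mat \<Rightarrow> real mat" where
  "pad_cols J p A =
     mat (dim_row A) p (\<lambda>(i, j). if j \<in> J then A $$ (i, card {a \<in> J. a < j}) else 0)"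

lemma pad_cols_carrier: "A \<in> carrier_mat n q \<Longrightarrow> pad_cols J p A \<in> carrier_mat n p"
  by (auto simp: pad_cols_def)

text \<open>The number of elements of \<open>J\<close> below \<open>j\<close> is the 0-based rank of
  \<open>j\<close> in \<open>J\<close>, inverse to \<open>pick J\<close>. It tells
  \<open>pad_cols\<close> which column of the small matrix to place at position
  \<open>j\<close>.\<close>

lemma bij_betw_rank:
  fixes J :: "nat set"
  assumes "finite J"
  shows "bij_betw (\<lambda>j. card {a \<in> J. a < j}) J {..<card J}"
proof (rule bij_betw_byWitness[where f' = "pick J"])
  show "(\<lambda>j. card {a \<in> J. a < j}) ` J \<subseteq> {..<card J}"
    using assms by (auto intro!: psubset_card_mono)
qed (use assms in \<open>auto simp: pick_card_in_set card_pick intro: pick_in_set\<close>)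

lemma rank_less_card:
  fixes j :: nat
  assumes "finite J" "j \<in> J"
  shows "card {a \<in> J. a < j} < card J"
  using bij_betw_rank[OF assms(1)] assms(2) by (auto dest: bij_betwE)

text \<open>Reindexing by rank collapses a zero-padded sum over all columns; norms and matrix
  products of padded matrices both reduce to this.\<close>

lemma sum_rank:
  fixes f :: "nat \<Rightarrow> real" and p :: nat
  assumes "J \<subseteq> {..<p}"
  shows "(\<Sum>j<p. if j \<in> J then f (card {a \<in> J. a < j}) else 0) = (\<Sum>k<card J. f k)"
proof -
  have fin: "finite J" using finite_subset[OF assms] by simp
  have "(\<Sum>j<p. if j \<in> J then f (card {a \<in> J. a < j}) else 0) = (\<Sum>j\<in>J. f (card {a \<in> J. a < j}))"
    using assms by (intro sum.mono_neutral_cong_right) auto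
  also have "\<dots> = (\<Sum>k<card J. f k)"
    using sum.reindex_bij_betw[OF bij_betw_rank[OF fin]] .
  finally show ?thesis .
qed

context
  fixes J :: "nat set" and p :: nat
  assumes J: "J \<subseteq> {..<p}"
begin

lemma finite_pad_index: "finite J"
  using finite_subset[OF J] by simp

lemma frob_norm_pad_cols:
  assumes "A \<in> carrier_mat n (card J)"
  shows "frob_norm (pad_cols J p A) = frob_norm A"
proof -
  have "(\<Sum>j<p. (pad_cols J p A $$ (i, j))\<^sup>2) = (\<Sum>k<card J. (A $$ (i, k))\<^sup>2)" if "i < n" for i
    using that assms
    by (subst sum_rank[OF J, symmetric]) (auto simp: pad_cols_def intro!: sum.cong)
  then show ?thesis
    using assms pad_cols_carrier[OF assms, of J p] unfolding frob_norm_def by auto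
qed

lemma pad_cols_diff:
  assumes "A \<in> carrier_mat n (card J)" "B \<in> carrier_mat n (card J)"
  shows "pad_cols J p A - pad_cols J p B = pad_cols J p (A - B)"
  \<comment> \<open>The rank bound keeps the column index inside the small matrices, where
    subtraction is entrywise.\<close>
  using assms rank_less_card[OF finite_pad_index]
  by (intro eq_matI) (auto simp: pad_cols_def)

lemma pair_dist_pad_cols:
  assumes "A \<in> carrier_mat n (card J)" "C \<in> carrier_mat n (card J)"
    and "B \<in> carrier_mat m (card J)" "D \<in> carrier_mat m (card J)"
  shows "pair_dist (pad_cols J p A, pad_cols J p B) (pad_cols J p C, pad_cols J p D) =
    pair_dist (A, B) (C, D)"
  using frob_norm_pad_cols[OF minus_carrier_mat[OF assms(2), of A]]
    frob_norm_pad_cols[OF minus_carrier_mat[OF assms(4), of B]]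
  by (simp add: pair_dist_def pad_cols_diff[OF assms(1,2)] pad_cols_diff[OF assms(3,4)])

lemma pad_cols_mult_transpose:
  assumes "A \<in> carrier_mat n (card J)" "B \<in> carrier_mat m (card J)"
  shows "pad_cols J p A * transpose_mat (pad_cols J p B) = A * transpose_mat B"
proof (rule eq_matI)
  fix i j assume "i < dim_row (A * transpose_mat B)" "j < dim_col (A * transpose_mat B)"
  then have ij: "i < n" "j < m" using assms by auto
  have "(pad_cols J p A * transpose_mat (pad_cols J p B)) $$ (i, j) =
      (\<Sum>k<p. if k \<in> J then A $$ (i, card {a \<in> J. a < k}) * B $$ (j, card {a \<in> J. a < k}) else 0)"
    using ij assms
    by (auto simp: scalar_prod_def pad_cols_def lessThan_atLeast0 intro!: sum.cong)
  also have "\<dots> = (\<Sum>k<card J. A $$ (i, k) * B $$ (j, k))"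
    by (rule sum_rank[OF J])
  also have "\<dots> = (A * transpose_mat B) $$ (i, j)"
    using ij assms by (auto simp: scalar_prod_def lessThan_atLeast0 intro!: sum.cong)
  finally show "(pad_cols J p A * transpose_mat (pad_cols J p B)) $$ (i, j) =
      (A * transpose_mat B) $$ (i, j)" .
qed (use assms in \<open>auto simp: pad_cols_def\<close>)

lemma nonneg_entries_pad_cols:
  assumes "A \<in> carrier_mat n (card J)"
  shows "nonneg_entries (pad_cols J p A) \<longleftrightarrow> nonneg_entries A"
proof
  assume nonneg: "nonneg_entries (pad_cols J p A)"
  show "nonneg_entries A"
    unfolding nonneg_entries_def
  proof (intro allI impI)
    fix i k assume ik: "i < dim_row A" "k < dim_col A"
    \<comment> \<open>Column \<open>k\<close> of \<open>A\<close> reappears in the padded matrix as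
      column \<open>pick J k\<close>, so no entry of \<open>A\<close> escapes the sign
      condition.\<close>
    then have "pick J k \<in> J" "card {a \<in> J. a < pick J k} = k"
      using assms by (auto intro!: pick_in_set card_pick)
    then show "0 \<le> A $$ (i, k)"
      using nonneg[unfolded nonneg_entries_def, rule_format, of i "pick J k"] ik J
      by (auto simp: pad_cols_def)
  qed
next
  assume "nonneg_entries A"
  then show "nonneg_entries (pad_cols J p A)"
    using assms rank_less_card[OF finite_pad_index] by (auto simp: nonneg_entries_def pad_cols_def)
qed

lemma norm20_pad_cols_le: "norm20 (pad_cols J p A) \<le> card J"
  unfolding norm20_def
  by (rule card_mono[OF finite_pad_index]) (auto simp: nonzero_cols_iff pad_cols_def split: if_splits)

lemma F_tilde_pad_cols:
  assumes "A \<in> carrier_mat n (card J)" "B \<in> carrier_mat m (card J)"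
  shows "F_tilde X \<mu> (pad_cols J p A, pad_cols J p B) = F_tilde X \<mu> (A, B)"
  using assms by (simp add: F_tilde_eq smooth_part_def frob_norm_pad_cols
      pad_cols_mult_transpose nonneg_entries_pad_cols)

lemma col_submatrix_carrier:
  assumes "W \<in> carrier_mat n p"
  shows "col_submatrix W J \<in> carrier_mat n (card J)"
proof -
  \<comment> \<open>The column count of a submatrix takes only indices of \<open>J\<close> below
    \<open>p\<close>; here these are all of \<open>J\<close>.\<close>
  have "{j. j < p \<and> j \<in> J} = J" using J by auto
  then show ?thesis
    using assms unfolding col_submatrix_def by (intro carrier_matI) (auto simp: dim_submatrix)
qed

text \<open>The columns dropped by the submatrix were zero, so padding restores them.\<close>

lemma pad_cols_col_submatrix:
  assumes W: "W \<in> carrier_mat n p" and cols: "nonzero_cols W \<subseteq> J"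
  shows "pad_cols J p (col_submatrix W J) = W"
proof (rule eq_matI)
  note sub = col_submatrix_carrier[OF W]
  fix i j assume "i < dim_row W" "j < dim_col W"
  then have ij: "i < n" "j < p" using W by auto
  show "pad_cols J p (col_submatrix W J) $$ (i, j) = W $$ (i, j)"
  proof (cases "j \<in> J")
    case True
    \<comment> \<open>All rows are kept: the rank of \<open>i\<close> in \<open>UNIV\<close> is
      \<open>i\<close> itself.\<close>
    have "submatrix W UNIV J $$ (card {a \<in> UNIV. a < i}, card {a \<in> J. a < j}) = W $$ (i, j)"
      using W ij True by (intro submatrix_index_card) auto
    then show ?thesis
      using True ij sub by (auto simp: pad_cols_def col_submatrix_def)
  next
    case False
    then have "j \<notin> nonzero_cols W" using cols by blast
    then show ?thesis
      using False W ij sub by (auto simp: pad_cols_def nonzero_cols_iff)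
  qed
qed (use W col_submatrix_carrier[OF W] in \<open>auto simp: pad_cols_def\<close>)

end

text \<open>Padding carries each nearby competitor in the small space to one equally near
  \<open>(U, V)\<close> with the same value of \<open>F_tilde\<close> and no larger sparsity term,
  so the growth inequality for \<open>Psi\<close> descends with the same
  \<open>\<alpha>\<close>.\<close>

lemma growth_minimizer_F_tilde_if_Psi:
  assumes "\<mu> > 0" "l \<ge> 0" "\<alpha> \<ge> 0"
    and min: "growth_minimizer \<alpha> (mat_pairs n m p) (Psi X l \<mu>) (U, V)"
    and J: "J = nonzero_cols U"
  shows "growth_minimizer \<alpha> (mat_pairs n m (card J)) (F_tilde X \<mu>)
    (col_submatrix U J, col_submatrix V J)"
proof -
  from min have U: "U \<in> carrier_mat n p" and V: "V \<in> carrier_mat m p"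
    and nonneg: "nonneg_entries U" "nonneg_entries V"
    by (auto simp: growth_minimizer_def mat_pairs_def Psi_eq split: if_splits)
  \<comment> \<open>Lowering the growth constant to 0 gives the plain minimality needed for equality
    of supports.\<close>
  have "local_minimizer (mat_pairs n m p) (Psi X l \<mu>) (U, V)"
    using growth_minimizer_mono[OF min] \<open>\<alpha> \<ge> 0\<close> by (simp add: local_minimizer_iff_growth)
  then have JV: "J = nonzero_cols V"
    using nonzero_cols_eq_if_local_minimizer_Psi \<open>\<mu> > 0\<close> J by blast
  have sub: "J \<subseteq> {..<p}" using U by (auto simp: J nonzero_cols_def)
  obtain \<epsilon> where \<epsilon>: "\<epsilon> > 0" and growth: "\<And>z. z \<in> mat_pairs n m p \<Longrightarrow> pair_dist z (U, V) < \<epsilon> \<Longrightarrow>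
      Psi X l \<mu> (U, V) + ereal (\<alpha> * (pair_dist z (U, V))\<^sup>2) \<le> Psi X l \<mu> z"
    using min by (auto simp: growth_minimizer_def)
  let ?U = "col_submatrix U J" and ?V = "col_submatrix V J"
  note carr = col_submatrix_carrier[OF sub U] col_submatrix_carrier[OF sub V]
  \<comment> \<open>\<open>J\<close> is defined from \<open>U\<close> alone; that \<open>V\<close>
    is also recovered rests on \<open>JV\<close>.\<close>
  have padU: "pad_cols J p ?U = U" and padV: "pad_cols J p ?V = V"
    using pad_cols_col_submatrix[OF sub U] pad_cols_col_submatrix[OF sub V] J JV by auto
  have F: "F_tilde X \<mu> (?U, ?V) = F_tilde X \<mu> (U, V)"
    using F_tilde_pad_cols[OF sub carr] by (simp add: padU padV)
  have "F_tilde X \<mu> (?U, ?V) + ereal (\<alpha> * (pair_dist (A, B) (?U, ?V))\<^sup>2) \<le> F_tilde X \<mu> (A, B)"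
    if AB: "A \<in> carrier_mat n (card J)" "B \<in> carrier_mat m (card J)"
      and d: "pair_dist (A, B) (?U, ?V) < \<epsilon>" for A B
  proof -
    let ?z = "(pad_cols J p A, pad_cols J p B)"
    have dist: "pair_dist ?z (U, V) = pair_dist (A, B) (?U, ?V)"
      using pair_dist_pad_cols[OF sub AB(1) carr(1) AB(2) carr(2)] by (simp add: padU padV)
    have "Psi X l \<mu> (U, V) + ereal (\<alpha> * (pair_dist ?z (U, V))\<^sup>2) \<le> Psi X l \<mu> ?z"
      using AB d dist by (intro growth) (auto simp: mat_pairs_def pad_cols_carrier)
    \<comment> \<open>Each padded factor has at most \<open>card J\<close> nonzero columns, and
      \<open>U\<close> and \<open>V\<close> both attain this number.\<close>
    moreover have "l * (real (norm20 (pad_cols J p A)) + real (norm20 (pad_cols J p B)))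
        \<le> l * (real (norm20 U) + real (norm20 V))"
      using norm20_pad_cols_le[OF sub, of A] norm20_pad_cols_le[OF sub, of B] \<open>l \<ge> 0\<close>
      by (intro mult_left_mono) (auto simp: norm20_def J[symmetric] JV[symmetric])
    ultimately have "F_tilde X \<mu> (U, V) + ereal (\<alpha> * (pair_dist ?z (U, V))\<^sup>2) \<le> F_tilde X \<mu> ?z"
      using nonneg by (auto simp: F_tilde_eq Psi_eq split: if_splits)
    then show ?thesis
      using F_tilde_pad_cols[OF sub AB] F dist by simp
  qed
  moreover have "\<bar>F_tilde X \<mu> (?U, ?V)\<bar> \<noteq> \<infinity>"
    using nonneg unfolding F by (simp add: F_tilde_eq)
  ultimately show ?thesis
    unfolding growth_minimizer_def mat_pairs_def using \<epsilon> carr by blast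
qed

theorem proposition5:
  fixes n m r :: nat and X U V :: "real mat" and l \<mu> :: real and J :: "nat set"
  assumes "n > 0" and "m > 0" and "r > 0"
    and "X \<in> carrier_mat n m" and "nonneg_entries X"
    and "l > 0" and "\<mu> > 0"
    and "U \<in> carrier_mat n r" and "V \<in> carrier_mat m r"
    and "J = nonzero_cols U"
  shows "(local_minimizer (mat_pairs n m r) (F_tilde X \<mu>) (U, V) \<longrightarrow>
            local_minimizer (mat_pairs n m r) (Psi X l \<mu>) (U, V))
       \<and> (strong_local_minimizer (mat_pairs n m r) (F_tilde X \<mu>) (U, V) \<longrightarrow>
            strong_local_minimizer (mat_pairs n m r) (Psi X l \<mu>) (U, V))
       \<and> (local_minimizer (mat_pairs n m r) (Psi X l \<mu>) (U, V) \<and>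
            (U, V) \<noteq> (0\<^sub>m n r, 0\<^sub>m m r) \<longrightarrow>
            local_minimizer (mat_pairs n m (card J)) (F_tilde X \<mu>)
              (col_submatrix U J, col_submatrix V J))
       \<and> (strong_local_minimizer (mat_pairs n m r) (Psi X l \<mu>) (U, V) \<and>
            (U, V) \<noteq> (0\<^sub>m n r, 0\<^sub>m m r) \<longrightarrow>
            strong_local_minimizer (mat_pairs n m (card J)) (F_tilde X \<mu>)
              (col_submatrix U J, col_submatrix V J))"
proof -
  have forward: "growth_minimizer \<alpha> (mat_pairs n m r) (Psi X l \<mu>) (U, V)"
    if "growth_minimizer \<alpha> (mat_pairs n m r) (F_tilde X \<mu>) (U, V)" for \<alpha>
    using growth_minimizer_Psi_if_F_tilde[OF _ that] \<open>l > 0\<close> by simp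
  have backward: "growth_minimizer \<alpha> (mat_pairs n m (card J)) (F_tilde X \<mu>)
      (col_submatrix U J, col_submatrix V J)"
    if "\<alpha> \<ge> 0" "growth_minimizer \<alpha> (mat_pairs n m r) (Psi X l \<mu>) (U, V)" for \<alpha>
    using growth_minimizer_F_tilde_if_Psi[OF \<open>\<mu> > 0\<close> _ that \<open>J = nonzero_cols U\<close>] \<open>l > 0\<close> by simp
  show ?thesis
    \<comment> \<open>The local claims are the case \<open>\<alpha> = 0\<close>; the strong ones use
      any \<open>\<alpha> > 0\<close>, which is carried over unchanged.\<close>
    unfolding local_minimizer_iff_growth strong_local_minimizer_iff_growth
    using forward backward by (meson less_imp_le order_refl)
qed

end
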